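(* Let $a,b,c$ be nonzero real constants, and let $A,C,M,N,R$ be real constants with $A\neq0$ and $C\neq 0$. Then, on the region $t\neq0$ (with real cube roots), the functions $$u(x,y,t)=-\frac{ax}{3}-\frac{x^2}{9t}+\frac{Mx}{t^{2/3}}+\frac{N}{t^{1/3}}+\frac{3Cy}{A\,t^{2/3}},\qquad v(x,y,t)=-\frac{y}{18ct}+\frac{R}{t^{2/3}}-\frac{b}{6c}$$ form a solution of the $(2+1)$-dimensional extended Boiti-Leon-Manna-Pempinelli system $$u_{ty}-a u_{xy}-b u_{yy}+u_{xxxy}+c\,(u_{yyyy}-6v u_{yy})-3(u_y u_{xx}+u_x u_{xy})=0,\qquad u_{yy}-v_x=0,$$ and this solution is invariant under the one-parameter group generated by the vector field $$v_1=\tfrac13 x\,\partial_x+\tfrac13 y\,\partial_y+t\,\partial_t+\frac{-2ax-3u}{9}\,\partial_u+\frac{-12cv-2b}{18c}\,\partial_v.$$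
   Context: A solution $(u(x,y,t),v(x,y,t))$ is invariant under the one-parameter group generated by $Z=\xi_x\partial_x+\xi_y\partial_y+\xi_t\partial_t+\eta_u\partial_u+\eta_v\partial_v$ if $\xi_xu_x+\xi_yu_y+\xi_tu_t=\eta_u$ and $\xi_xv_x+\xi_yv_y+\xi_tv_t=\eta_v$ along the solution, i.e. its graph is preserved by the flow of $Z$. Here $t^{1/3}$ is the real cube root and $t^{2/3}=(t^{1/3})^2$. *)

theory Defs
  imports "HOL-Analysis.Analysis"
begin

type_synonym field3 = "real \<Rightarrow> real \<Rightarrow> real \<Rightarrow> real"

definition Dx :: "field3 \<Rightarrow> field3" where
  "Dx f = (\<lambda>x y t. deriv (\<lambda>s. f s y t) x)"

definition Dy :: "field3 \<Rightarrow> field3" where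
  "Dy f = (\<lambda>x y t. deriv (\<lambda>s. f x s t) y)"

definition Dt :: "field3 \<Rightarrow> field3" where
  "Dt f = (\<lambda>x y t. deriv (\<lambda>s. f x y s) t)"

text \<open>Regularity is part of the notion of a solution: \<open>deriv\<close> is unspecified at points
  where the function is not differentiable.\<close>

primrec Ck_on :: "nat \<Rightarrow> (real \<times> real \<times> real) set \<Rightarrow> field3 \<Rightarrow> bool" where
  "Ck_on 0 D f \<longleftrightarrow> continuous_on D (\<lambda>(x, y, t). f x y t)"
| "Ck_on (Suc k) D f \<longleftrightarrow>
     continuous_on D (\<lambda>(x, y, t). f x y t) \<and>
     (\<forall>(x, y, t) \<in> D.
        (\<lambda>s. f s y t) field_differentiable at x \<and>
        (\<lambda>s. f x s t) field_differentiable at y \<and>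
        (\<lambda>s. f x y s) field_differentiable at t) \<and>
     Ck_on k D (Dx f) \<and> Ck_on k D (Dy f) \<and> Ck_on k D (Dt f)"

text \<open>Subscripts are read from left to right: $u_{xxxy}$ is \<open>Dy (Dx (Dx (Dx u)))\<close>.\<close>

definition eBLMP_solution ::
  "real \<Rightarrow> real \<Rightarrow> real \<Rightarrow> (real \<times> real \<times> real) set \<Rightarrow> field3 \<Rightarrow> field3 \<Rightarrow> bool" where
  "eBLMP_solution a b c D u v \<longleftrightarrow>
     Ck_on 4 D u \<and> Ck_on 1 D v \<and>
     (\<forall>(x, y, t) \<in> D.
        Dy (Dt u) x y t - a * Dy (Dx u) x y t - b * Dy (Dy u) x y t
        + Dy (Dx (Dx (Dx u))) x y t
        + c * (Dy (Dy (Dy (Dy u))) x y t - 6 * v x y t * Dy (Dy u) x y t)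
        - 3 * (Dy u x y t * Dx (Dx u) x y t + Dx u x y t * Dy (Dx u) x y t) = 0 \<and>
        Dy (Dy u) x y t - Dx v x y t = 0)"

text \<open>Points of the total space are \<open>(x, y, t, u, v)\<close>; a vector field maps such a point to its
  components \<open>(\<xi>x, \<xi>y, \<xi>t, \<eta>u, \<eta>v)\<close>.\<close>

type_synonym jet0 = "real \<times> real \<times> real \<times> real \<times> real"

definition infinitesimally_invariant ::
  "(jet0 \<Rightarrow> jet0) \<Rightarrow> (real \<times> real \<times> real) set \<Rightarrow> field3 \<Rightarrow> field3 \<Rightarrow> bool" where
  "infinitesimally_invariant Z D u v \<longleftrightarrow>
     (\<forall>(x, y, t) \<in> D.
        case Z (x, y, t, u x y t, v x y t) of (\<xi>x, \<xi>y, \<xi>t, \<eta>u, \<eta>v) \<Rightarrow>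
          \<xi>x * Dx u x y t + \<xi>y * Dy u x y t + \<xi>t * Dt u x y t = \<eta>u \<and>
          \<xi>x * Dx v x y t + \<xi>y * Dy v x y t + \<xi>t * Dt v x y t = \<eta>v)"

definition graph_on :: "(real \<times> real \<times> real) set \<Rightarrow> field3 \<Rightarrow> field3 \<Rightarrow> jet0 set" where
  "graph_on D u v = (\<lambda>(x, y, t). (x, y, t, u x y t, v x y t)) ` D"

definition one_parameter_group_of :: "(jet0 \<Rightarrow> jet0) \<Rightarrow> (real \<Rightarrow> jet0 \<Rightarrow> jet0) \<Rightarrow> bool" where
  "one_parameter_group_of Z \<phi> \<longleftrightarrow>
     \<phi> 0 = id \<and> (\<forall>r s. \<phi> (r + s) = \<phi> r \<circ> \<phi> s) \<and>
     (\<forall>p s. ((\<lambda>s. \<phi> s p) has_vector_derivative Z (\<phi> s p)) (at s))"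

text \<open>The infinitesimal condition and the invariance of the graph under the (global) flow are
  both required. A flow of a locally Lipschitz field, such as an affine one, is unique, so for
  such fields \<open>\<phi>\<close> is determined by \<open>Z\<close>.\<close>

definition invariant_under_group_of ::
  "(jet0 \<Rightarrow> jet0) \<Rightarrow> (real \<times> real \<times> real) set \<Rightarrow> field3 \<Rightarrow> field3 \<Rightarrow> bool" where
  "invariant_under_group_of Z D u v \<longleftrightarrow>
     infinitesimally_invariant Z D u v \<and>
     (\<exists>\<phi>. one_parameter_group_of Z \<phi> \<and> (\<forall>s. \<phi> s ` graph_on D u v = graph_on D u v))"

definition v1_field :: "real \<Rightarrow> real \<Rightarrow> real \<Rightarrow> jet0 \<Rightarrow> jet0" where
  "v1_field a b c = (\<lambda>(x, y, t, u, v).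
     (x / 3, y / 3, t, (- 2 * a * x - 3 * u) / 9, (- 12 * c * v - 2 * b) / (18 * c)))"

end

theory Submission
  imports Defs
begin

text \<open>
  On \<open>t \<noteq> 0\<close> both functions are finite sums of monomials
  \<open>c x\<^sup>i y\<^sup>j r\<^sup>k\<close> with \<open>r\<close> the real cube root of \<open>t\<close> and \<open>k\<close> an integer. Since
  \<open>dr\<^sup>k/dt = (k/3) r\<^sup>k\<^sup>-\<^sup>3\<close>, this class is closed under all partial derivatives, so its members
  are smooth and the differential equations become identities between coefficients.

  The field \<open>v\<^sub>1\<close> scales \<open>(x, y, t)\<close> with weights \<open>(1/3, 1/3, 1)\<close>; in the shifted
  variables \<open>u + a x/3\<close> and \<open>v + b/(6c)\<close> it also scales, with weights \<open>-1/3\<close> and \<open>-2/3\<close>. Its flow is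
  therefore explicit, and the solution is homogeneous of exactly these weights.
\<close>

section \<open>Monomials in \<open>x\<close>, \<open>y\<close> and the real cube root of
  \<open>t\<close>\<close>

type_synonym monom3 = "real \<times> nat \<times> nat \<times> int"

definition eval_monom :: "monom3 \<Rightarrow> field3" where
  "eval_monom = (\<lambda>(c, i, j, k) x y t. c * x ^ i * y ^ j * root 3 t powi k)"

definition eval_monoms :: "monom3 list \<Rightarrow> field3" where
  "eval_monoms ms x y t = (\<Sum>m\<leftarrow>ms. eval_monom m x y t)"

text \<open>For \<open>i = 0\<close> the truncated exponent \<open>i - 1\<close> is harmless, since the coefficient vanishes.\<close>

definition mono_dx :: "monom3 \<Rightarrow> monom3" where
  "mono_dx = (\<lambda>(c, i, j, k). (c * real i, i - 1, j, k))"

definition mono_dy :: "monom3 \<Rightarrow> monom3" where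
  "mono_dy = (\<lambda>(c, i, j, k). (c * real j, i, j - 1, k))"

definition mono_dt :: "monom3 \<Rightarrow> monom3" where
  "mono_dt = (\<lambda>(c, i, j, k). (c * of_int k / 3, i, j, k - 3))"

lemma eval_monoms_simps [simp]:
  "eval_monoms [] x y t = 0"
  "eval_monoms (m # ms) x y t = eval_monom m x y t + eval_monoms ms x y t"
  by (simp_all add: eval_monoms_def)

text \<open>Chain rule: with \<open>r = root 3 t\<close>, \<open>dr/dt = 1 / (3 * r ^ 2)\<close>,
  which holds for negative \<open>t\<close> too because 3 is odd. The factor \<open>r ^ 2\<close>
  lowers the exponent from \<open>k - 1\<close> to \<open>k - 3\<close>.\<close>

lemma has_field_derivative_root3_powi:
  fixes t :: real
  assumes "t \<noteq> 0"
  shows "((\<lambda>s. root 3 s powi k) has_field_derivative of_int k / 3 * root 3 t powi (k - 3)) (at t)"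
proof -
  have r: "root 3 t \<noteq> 0" using assms by simp
  have d: "(root 3 has_field_derivative inverse (3 * root 3 t ^ 2)) (at t)"
    using DERIV_odd_real_root[of 3 t] assms by simp
  have "root 3 t powi (k - 1) = root 3 t powi (k - 3) * root 3 t ^ 2"
    using power_int_add[of "root 3 t" "k - 3" 2] r by simp
  then have eq: "of_int k * root 3 t powi (k - 1) * inverse (3 * root 3 t ^ 2)
      = of_int k / 3 * root 3 t powi (k - 3)"
    using r by (simp add: field_simps)
  show ?thesis
    using DERIV_power_int[OF d disjI2[OF r], of k] by (simp only: eq)
qed

lemma eval_monom_has_derivative:
  "((\<lambda>s. eval_monom m s y t) has_field_derivative eval_monom (mono_dx m) x y t) (at x)"
  "((\<lambda>s. eval_monom m x s t) has_field_derivative eval_monom (mono_dy m) x y t) (at y)"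
  "t \<noteq> 0 \<Longrightarrow>
    ((\<lambda>s. eval_monom m x y s) has_field_derivative eval_monom (mono_dt m) x y t) (at t)"
  unfolding eval_monom_def mono_dx_def mono_dy_def mono_dt_def case_prod_unfold
  by (auto intro!: derivative_eq_intros
      DERIV_cong[OF DERIV_cmult[OF has_field_derivative_root3_powi]])

lemma eval_monoms_has_derivative:
  "((\<lambda>s. eval_monoms ms s y t) has_field_derivative eval_monoms (map mono_dx ms) x y t) (at x)"
  "((\<lambda>s. eval_monoms ms x s t) has_field_derivative eval_monoms (map mono_dy ms) x y t) (at y)"
  "t \<noteq> 0 \<Longrightarrow>
    ((\<lambda>s. eval_monoms ms x y s) has_field_derivative eval_monoms (map mono_dt ms) x y t) (at t)"
  unfolding eval_monoms_def
  by (induction ms) (simp_all add: DERIV_add eval_monom_has_derivative)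

lemma continuous_on_eval_monoms:
  "continuous_on {(x, y, t). t \<noteq> 0} (\<lambda>(x, y, t). eval_monoms ms x y t)"
proof (induction ms)
  case Nil
  then show ?case by simp
next
  case (Cons m ms)
  have "continuous_on {(x, y, t). t \<noteq> 0} (\<lambda>(x, y, t). eval_monom m x y t)"
    unfolding eval_monom_def case_prod_unfold
    by (auto intro!: continuous_intros)
  from continuous_on_add[OF this Cons] show ?case
    by (simp add: case_prod_unfold)
qed

section \<open>Functions given by monomials away from \<open>t = 0\<close>\<close>

definition represented_by :: "field3 \<Rightarrow> monom3 list \<Rightarrow> bool" where
  "represented_by f ms \<longleftrightarrow> (\<forall>x y t. t \<noteq> 0 \<longrightarrow> f x y t = eval_monoms ms x y t)"

lemma represented_has_derivative:
  assumes "represented_by f ms" and "t \<noteq> 0"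
  shows "((\<lambda>s. f s y t) has_field_derivative eval_monoms (map mono_dx ms) x y t) (at x)"
    and "((\<lambda>s. f x s t) has_field_derivative eval_monoms (map mono_dy ms) x y t) (at y)"
    and "((\<lambda>s. f x y s) has_field_derivative eval_monoms (map mono_dt ms) x y t) (at t)"
proof -
  \<comment> \<open>Along \<open>x\<close> and \<open>y\<close> the two functions agree on the whole
    line; along \<open>t\<close> they agree only on the open set of nonzero reals, so the derivative
    is transferred locally.\<close>
  show "((\<lambda>s. f x y s) has_field_derivative eval_monoms (map mono_dt ms) x y t) (at t)"
    using eval_monoms_has_derivative(3)[OF assms(2)] open_delete[OF open_UNIV, of 0]
    by (rule has_field_derivative_transform_within_open)
      (use assms in \<open>auto simp: represented_by_def\<close>)
qed (use assms eval_monoms_has_derivative in \<open>simp_all add: represented_by_def\<close>)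

lemma represented_by_partial:
  assumes "represented_by f ms"
  shows "represented_by (Dx f) (map mono_dx ms)"
    and "represented_by (Dy f) (map mono_dy ms)"
    and "represented_by (Dt f) (map mono_dt ms)"
  using represented_has_derivative[OF assms]
  by (auto simp: represented_by_def Dx_def Dy_def Dt_def intro!: DERIV_imp_deriv)

text \<open>Partial derivatives of a represented function are again represented, so induction on
  \<open>k\<close> works once \<open>f\<close> and \<open>ms\<close> are generalised.\<close>

lemma Ck_on_represented:
  "represented_by f ms \<Longrightarrow> Ck_on k {(x, y, t). t \<noteq> 0} f"
proof (induction k arbitrary: f ms)
  case (0 f ms)
  have "continuous_on {(x, y, t). t \<noteq> 0} (\<lambda>(x, y, t). f x y t)"
    by (rule continuous_on_eq[OF continuous_on_eval_monoms[of ms]])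
      (use 0 in \<open>auto simp: represented_by_def\<close>)
  then show ?case by simp
next
  case (Suc k f ms)
  have "continuous_on {(x, y, t). t \<noteq> 0} (\<lambda>(x, y, t). f x y t)"
    by (rule continuous_on_eq[OF continuous_on_eval_monoms[of ms]])
      (use Suc.prems in \<open>auto simp: represented_by_def\<close>)
  moreover note represented_by_partial[OF Suc.prems, THEN Suc.IH]
  moreover have "(\<lambda>s. f s y t) field_differentiable at x"
    "(\<lambda>s. f x s t) field_differentiable at y" "(\<lambda>s. f x y s) field_differentiable at t"
    if "t \<noteq> 0" for x y t
    unfolding field_differentiable_def
    using represented_has_derivative[OF Suc.prems that] by blast+
  ultimately show ?case by simp
qed

section \<open>Weights and homogeneity\<close>

definition weight :: "monom3 \<Rightarrow> int" where
  "weight = (\<lambda>(c, i, j, k). int i + int j + k)"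

lemma root3_cubed: "root 3 t ^ 3 = t"
  by (rule odd_real_root_pow) simp

text \<open>Euler's identity: the generator of the scaling acts diagonally on monomials. The factor
  1/3 appears because \<open>t\<close> counts as the cube of a quantity of weight 1.\<close>

lemma eval_monom_euler:
  assumes "t \<noteq> 0"
  shows "x / 3 * eval_monom (mono_dx m) x y t + y / 3 * eval_monom (mono_dy m) x y t
      + t * eval_monom (mono_dt m) x y t = of_int (weight m) / 3 * eval_monom m x y t"
proof -
  obtain c i j k where m: "m = (c, i, j, k)" by (cases m)
  \<comment> \<open>Multiplying by \<open>z\<close> restores the lowered exponent; at
    \<open>n = 0\<close>, where \<open>n - 1\<close> truncates, both sides vanish.\<close>
  have p: "z * (real n * z ^ (n - 1)) = real n * z ^ n" for z :: real and n
    by (cases n) simp_all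
  have q: "t * root 3 t powi (k - 3) = root 3 t powi k"
    using power_int_add[of "root 3 t" 3 "k - 3"] assms by (simp add: root3_cubed)
  have "x / 3 * eval_monom (mono_dx m) x y t + y / 3 * eval_monom (mono_dy m) x y t
      + t * eval_monom (mono_dt m) x y t
      = c / 3 * ((x * (real i * x ^ (i - 1))) * y ^ j * root 3 t powi k
          + x ^ i * (y * (real j * y ^ (j - 1))) * root 3 t powi k
          + of_int k * x ^ i * y ^ j * (t * root 3 t powi (k - 3)))"
    unfolding m eval_monom_def mono_dx_def mono_dy_def mono_dt_def prod.case
    by (simp add: algebra_simps)
  also have "\<dots> = of_int (weight m) / 3 * eval_monom m x y t"
    unfolding p q m eval_monom_def weight_def prod.case by (simp add: algebra_simps)
  finally show ?thesis .
qed

text \<open>Finite form of Euler's identity: scaling \<open>t\<close> by \<open>e ^ 3\<close> scales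
  its cube root by \<open>e\<close>.\<close>

lemma eval_monom_scale:
  assumes "e > 0" and "t \<noteq> 0"
  shows "eval_monom m (x * e) (y * e) (t * e ^ 3) = e powi weight m * eval_monom m x y t"
proof -
  obtain c i j k where m: "m = (c, i, j, k)" by (cases m)
  have "root 3 (t * e ^ 3) = root 3 t * e"
    using assms by (simp add: real_root_mult real_root_power_cancel)
  moreover have "e powi (int i + int j + k) = e ^ i * e ^ j * e powi k"
    using assms by (simp add: power_int_add)
  ultimately show ?thesis
    unfolding m eval_monom_def weight_def prod.case
    by (simp add: power_mult_distrib power_int_mult_distrib)
qed

section \<open>The flow of the vector field\<close>

text \<open>In \<open>U = u + a * x / 3\<close> and \<open>V = v + b / (6 * c)\<close> the field
  reads \<open>U' = - U / 3\<close>, \<open>V' = - 2 * V / 3\<close>. The last summands undo the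
  shifts at the moved point, hence \<open>exp (s / 3)\<close> beside
  \<open>a * x / 3\<close>.\<close>

definition v1_flow :: "real \<Rightarrow> real \<Rightarrow> real \<Rightarrow> real \<Rightarrow> jet0 \<Rightarrow> jet0" where
  "v1_flow a b c s = (\<lambda>(x, y, t, u, v).
     (x * exp (s / 3), y * exp (s / 3), t * exp s,
      (u + a * x / 3) * exp (- s / 3) - a * x / 3 * exp (s / 3),
      (v + b / (6 * c)) * exp (- 2 * s / 3) - b / (6 * c)))"

lemma v1_flow_add: "v1_flow a b c (r + s) = v1_flow a b c r \<circ> v1_flow a b c s"
proof -
  have "(r + s) / 3 = r / 3 + s / 3" "- (r + s) / 3 = - r / 3 + - s / 3"
    "- 2 * (r + s) / 3 = - 2 * r / 3 + - 2 * s / 3"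
    by (simp_all add: field_simps)
  note exps = this[THEN arg_cong[where f = exp], unfolded exp_add] exp_add[of r s]
  show ?thesis
    unfolding v1_flow_def fun_eq_iff exps by (auto simp: algebra_simps)
qed

lemma one_parameter_group_of_v1_flow:
  assumes "c \<noteq> 0"
  shows "one_parameter_group_of (v1_field a b c) (v1_flow a b c)"
  unfolding one_parameter_group_of_def
proof (intro conjI allI)
  show "v1_flow a b c 0 = id"
    by (auto simp: v1_flow_def fun_eq_iff)
  show "v1_flow a b c (r + s) = v1_flow a b c r \<circ> v1_flow a b c s" for r s
    by (rule v1_flow_add)
  fix p :: jet0 and s :: real
  obtain x y t u v where p: "p = (x, y, t, u, v)" by (cases p)
  \<comment> \<open>With the exponentials named, the final comparison with \<open>v1_field\<close>
    is an identity linear in \<open>E\<close>, \<open>E'\<close> and \<open>E''\<close>.\<close>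
  define E where "E = exp (s / 3)"
  define E' where "E' = exp (- s / 3)"
  define E'' where "E'' = exp (- 2 * s / 3)"
  note E_defs = E_def E'_def E''_def
  have "((\<lambda>s. k * exp (s / 3)) has_real_derivative k * E / 3) (at s)"
    "((\<lambda>s. k * exp s) has_real_derivative k * exp s) (at s)"
    "((\<lambda>s. k * exp (- s / 3) - l * exp (s / 3)) has_real_derivative
      - k * E' / 3 - l * E / 3) (at s)"
    "((\<lambda>s. k * exp (- 2 * s / 3) - l) has_real_derivative - 2 * k * E'' / 3) (at s)"
    for k l :: real
    unfolding E_defs by (auto intro!: derivative_eq_intros simp: mult.commute)
  note deriv = this[unfolded has_real_derivative_iff_has_vector_derivative]
  have "((\<lambda>s. v1_flow a b c s p) has_vector_derivative
      (x * E / 3, y * E / 3, t * exp s,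
       - (u + a * x / 3) * E' / 3 - a * x / 3 * E / 3, - 2 * (v + b / (6 * c)) * E'' / 3)) (at s)"
    unfolding v1_flow_def p prod.case by (intro has_vector_derivative_Pair deriv)
  also have "(x * E / 3, y * E / 3, t * exp s,
       - (u + a * x / 3) * E' / 3 - a * x / 3 * E / 3, - 2 * (v + b / (6 * c)) * E'' / 3)
      = v1_field a b c (v1_flow a b c s p)"
    unfolding v1_flow_def v1_field_def p prod.case E_defs[symmetric]
    using assms by (simp add: field_simps)
  finally show "((\<lambda>s. v1_flow a b c s p) has_vector_derivative
      v1_field a b c (v1_flow a b c s p)) (at s)" .
qed

text \<open>The inverse of \<open>\<phi> s\<close> is \<open>\<phi> (- s)\<close>, which also maps
  \<open>G\<close> into itself, so every point of \<open>G\<close> has a preimage in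
  \<open>G\<close>.\<close>

lemma one_parameter_group_image_eq:
  assumes "one_parameter_group_of Z \<phi>" and sub: "\<And>s. \<phi> s ` G \<subseteq> G"
  shows "\<phi> s ` G = G"
proof
  show "G \<subseteq> \<phi> s ` G"
  proof
    fix p assume "p \<in> G"
    have "\<phi> s (\<phi> (- s) p) = p"
      using assms(1) unfolding one_parameter_group_of_def
      by (metis add.right_inverse comp_apply id_apply)
    moreover have "\<phi> (- s) p \<in> G" using sub \<open>p \<in> G\<close> by blast
    ultimately show "p \<in> \<phi> s ` G" by (metis imageI)
  qed
qed (rule sub)

theorem mainTheorem5:
  fixes a b c A C M N R :: real
    and u v :: "real \<Rightarrow> real \<Rightarrow> real \<Rightarrow> real"
    and D :: "(real \<times> real \<times> real) set"
  assumes "a \<noteq> 0" and "b \<noteq> 0" and "c \<noteq> 0" and "A \<noteq> 0" and "C \<noteq> 0"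
    and "D = {(x, y, t). t \<noteq> 0}"
    and "u = (\<lambda>x y t. - (a * x / 3) - x ^ 2 / (9 * t) + M * x / (root 3 t) ^ 2 + N / root 3 t
                + 3 * C * y / (A * (root 3 t) ^ 2))"
    and "v = (\<lambda>x y t. - (y / (18 * c * t)) + R / (root 3 t) ^ 2 - b / (6 * c))"
  shows "eBLMP_solution a b c D u v \<and> invariant_under_group_of (v1_field a b c) D u v"
proof -
  \<comment> \<open>\<open>mu1\<close> and \<open>mv1\<close> are the shifted unknowns
    \<open>u + a * x / 3\<close> and \<open>v + b / (6 * c)\<close>; all their monomials have weight
    -1 and -2 respectively.\<close>
  define mu1 :: "monom3 list" where
    "mu1 = [(- 1 / 9, 2, 0, - 3), (M, 1, 0, - 2), (N, 0, 0, - 1), (3 * C / A, 0, 1, - 2)]"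
  define mu where "mu = (- a / 3, 1, 0, 0) # mu1"
  define mv1 :: "monom3 list" where
    "mv1 = [(- 1 / (18 * c), 0, 1, - 3), (R, 0, 0, - 2)]"
  define mv where "mv = (- b / (6 * c), 0, 0, 0) # mv1"
  note mono_defs = mu_def mv_def mu1_def mv1_def eval_monom_def mono_dx_def mono_dy_def mono_dt_def
  have ru: "represented_by u mu"
    unfolding represented_by_def assms(7)
    by (simp add: mono_defs power_int_minus_divide inverse_eq_divide root3_cubed mult_ac)
  have rv: "represented_by v mv"
    unfolding represented_by_def assms(8)
    by (simp add: mono_defs power_int_minus_divide inverse_eq_divide root3_cubed mult_ac)
  note u_eq = ru[unfolded represented_by_def, rule_format]
    and v_eq = rv[unfolded represented_by_def, rule_format]
  note d = represented_by_partial
  note eqs = d(1)[OF ru] d(2)[OF ru] d(3)[OF ru] d(1)[OF d(1)[OF ru]] d(2)[OF d(1)[OF ru]]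
    d(2)[OF d(2)[OF ru]] d(2)[OF d(3)[OF ru]] d(2)[OF d(1)[OF d(1)[OF d(1)[OF ru]]]]
    d(2)[OF d(2)[OF d(2)[OF d(2)[OF ru]]]] d(1)[OF rv] d(2)[OF rv] d(3)[OF rv]
  note eval = eqs[unfolded represented_by_def, rule_format]
  have "eBLMP_solution a b c D u v"
    unfolding eBLMP_solution_def
  proof (intro conjI)
    show "Ck_on 4 D u" "Ck_on 1 D v"
      using Ck_on_represented[OF ru] Ck_on_represented[OF rv] assms(6) by simp_all
    \<comment> \<open>Only \<open>u_ty\<close> and \<open>- 3 * u_y * u_xx\<close> survive in the
      first equation. They are \<open>- 2 * C / A\<close> and \<open>2 * C / A\<close> times this
      power, one as a single power and the other as a product.\<close>
    have "root 3 t powi - 5 = root 3 t powi - 2 * root 3 t powi - 3" if "t \<noteq> 0" for t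
      using power_int_add[of "root 3 t" "- 2" "- 3"] that by simp
    then show "\<forall>(x, y, t) \<in> D.
        Dy (Dt u) x y t - a * Dy (Dx u) x y t - b * Dy (Dy u) x y t
        + Dy (Dx (Dx (Dx u))) x y t
        + c * (Dy (Dy (Dy (Dy u))) x y t - 6 * v x y t * Dy (Dy u) x y t)
        - 3 * (Dy u x y t * Dx (Dx u) x y t + Dx u x y t * Dy (Dx u) x y t) = 0 \<and>
        Dy (Dy u) x y t - Dx v x y t = 0"
      unfolding assms(6) by (auto simp: eval mono_defs)
  qed
  moreover have "infinitesimally_invariant (v1_field a b c) D u v"
  proof -
    have "x / 3 * Dx u x y t + y / 3 * Dy u x y t + t * Dt u x y t = (- 2 * a * x - 3 * u x y t) / 9"
      "x / 3 * Dx v x y t + y / 3 * Dy v x y t + t * Dt v x y t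
        = (- 12 * c * v x y t - 2 * b) / (18 * c)"
      if t: "t \<noteq> 0" for x y t
    proof -
      note euler = eval_monom_euler[OF t, of x _ y]
      have "x / 3 * eval_monoms (map mono_dx mu1) x y t + y / 3 * eval_monoms (map mono_dy mu1) x y t
          + t * eval_monoms (map mono_dt mu1) x y t = - 1 / 3 * eval_monoms mu1 x y t"
        using euler[of "mu1 ! 0"] euler[of "mu1 ! 1"] euler[of "mu1 ! 2"] euler[of "mu1 ! 3"]
        by (simp add: mu1_def weight_def algebra_simps)
      \<comment> \<open>The remaining term \<open>- a * x / 3\<close> contributes
        \<open>- a * x / 9\<close> on both sides: on the right, \<open>- 2 * a * x / 9\<close> plus
        \<open>a * x / 9\<close> from \<open>- u / 3\<close>.\<close>
      then show "x / 3 * Dx u x y t + y / 3 * Dy u x y t + t * Dt u x y t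
          = (- 2 * a * x - 3 * u x y t) / 9"
        by (simp add: eval[OF t] u_eq[OF t] mu_def eval_monom_def mono_dx_def mono_dy_def
            mono_dt_def field_simps)
      have "x / 3 * eval_monoms (map mono_dx mv1) x y t + y / 3 * eval_monoms (map mono_dy mv1) x y t
          + t * eval_monoms (map mono_dt mv1) x y t = - 2 / 3 * eval_monoms mv1 x y t"
        using euler[of "mv1 ! 0"] euler[of "mv1 ! 1"]
        by (simp add: mv1_def weight_def algebra_simps)
      moreover have "(- 12 * c * v x y t - 2 * b) / (18 * c) = - 2 / 3 * eval_monoms mv1 x y t"
        using assms(3) by (simp add: v_eq[OF t] mv_def eval_monom_def field_simps)
      ultimately show "x / 3 * Dx v x y t + y / 3 * Dy v x y t + t * Dt v x y t
          = (- 12 * c * v x y t - 2 * b) / (18 * c)"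
        by (simp add: eval[OF t] mv_def eval_monom_def mono_dx_def mono_dy_def mono_dt_def)
    qed
    then show ?thesis
      unfolding infinitesimally_invariant_def v1_field_def assms(6) by auto
  qed
  moreover have "v1_flow a b c s ` graph_on D u v \<subseteq> graph_on D u v" for s
  proof -
    define e where "e = exp (s / 3)"
    have e: "e > 0" by (simp add: e_def)
    have exps: "exp s = e ^ 3" "exp (- s / 3) = 1 / e" "exp (- 2 * s / 3) = 1 / e ^ 2"
      using exp_of_nat_mult[of 3 "s / 3"] exp_of_nat_mult[of 2 "s / 3"]
      by (simp_all add: e_def exp_minus inverse_eq_divide)
    \<comment> \<open>Homogeneity of the shifted unknowns, written in the form of the last two
      components of \<open>v1_flow\<close>.\<close>
    have uhom: "u (x * e) (y * e) (t * e ^ 3) = (u x y t + a * x / 3) / e - a * x / 3 * e"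
      and vhom: "v (x * e) (y * e) (t * e ^ 3) = (v x y t + b / (6 * c)) / e ^ 2 - b / (6 * c)"
      if t: "t \<noteq> 0" for x y t
    proof -
      have t': "t * e ^ 3 \<noteq> 0" using t e by simp
      have "eval_monoms mu1 (x * e) (y * e) (t * e ^ 3) = eval_monoms mu1 x y t / e"
        by (simp add: mu1_def eval_monom_scale[OF e t] weight_def inverse_eq_divide
            add_divide_distrib)
      then show "u (x * e) (y * e) (t * e ^ 3) = (u x y t + a * x / 3) / e - a * x / 3 * e"
        by (simp add: u_eq[OF t] u_eq[OF t'] mu_def eval_monom_def)
      have "eval_monoms mv1 (x * e) (y * e) (t * e ^ 3) = eval_monoms mv1 x y t / e ^ 2"
        by (simp add: mv1_def eval_monom_scale[OF e t] weight_def power_int_minus_divide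
            add_divide_distrib)
      then show "v (x * e) (y * e) (t * e ^ 3) = (v x y t + b / (6 * c)) / e ^ 2 - b / (6 * c)"
        by (simp add: v_eq[OF t] v_eq[OF t'] mv_def eval_monom_def)
    qed
    show ?thesis
    proof (clarsimp simp: graph_on_def assms(6))
      fix x y t :: real assume t: "t \<noteq> 0"
      \<comment> \<open>The flow carries the graph point over \<open>(x, y, t)\<close> to the one
        over \<open>(x * e, y * e, t * e ^ 3)\<close>, whose time is again nonzero.\<close>
      have "v1_flow a b c s (x, y, t, u x y t, v x y t)
          = (\<lambda>(x, y, t). (x, y, t, u x y t, v x y t)) (x * e, y * e, t * e ^ 3)"
        unfolding v1_flow_def prod.case exps e_def[symmetric] uhom[OF t] vhom[OF t] by simp
      then show "v1_flow a b c s (x, y, t, u x y t, v x y t)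
          \<in> (\<lambda>(x, y, t). (x, y, t, u x y t, v x y t)) ` {(x, y, t). t \<noteq> 0}"
        by (rule image_eqI) (use t e in simp)
    qed
  qed
  ultimately show ?thesis
    unfolding invariant_under_group_of_def
    using one_parameter_group_of_v1_flow[OF assms(3)] one_parameter_group_image_eq by blast
qed

end
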